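(* Let $n\geqslant 1$, $N=\{1,\dots,n\}$, and let $\nu$ be a game on $N$. Let $X_1,\dots,X_n$ be i.i.d. random variables with the standard exponential distribution, i.e. with cumulative distribution function $F(x)=1-e^{-x}$ for $x\geqslant 0$ (and $F(x)=0$ for $x<0$), and let $Y_\nu:=C_\nu(X_1,\dots,X_n)$. Assume that for every $\sigma\in\mathfrak{S}_n$ one has $\nu_i^\sigma/i\neq\nu_k^\sigma/k$ for all $i,k\in N$ with $i\neq k$, and $\nu_i^\sigma/i>0$ for all $i\in N$. Then $Y_\nu$ has a probability density function $f_\nu$ given, for $y\geqslant 0$, by $$f_\nu(y)=\frac{1}{n!}\sum_{\sigma\in\mathfrak{S}_n}\sum_{i=1}^n\frac{(\nu_i^\sigma/i)^{n-2}}{\prod_{k\in N,\,k\neq i}(\nu_i^\sigma/i-\nu_k^\sigma/k)}\exp\left(-\frac{y}{\nu_i^\sigma/i}\right),$$ and $f_\nu(y)=0$ for $y<0$.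
   Context: $\mathfrak{S}_n$ denotes the set of permutations of $N=\{1,\dots,n\}$. A game on $N$ is a set function $\nu:2^N\to[0,1]$ with $\nu(\varnothing)=0$ (no monotonicity is required). For $\sigma\in\mathfrak{S}_n$ and $i=0,\dots,n$, let $\nu_i^\sigma:=\nu(\{\sigma(1),\dots,\sigma(i)\})$ (so $\nu_0^\sigma=0$), and for $i\in N$ let $p_i^{\nu,\sigma}:=\nu_i^\sigma-\nu_{i-1}^\sigma$. The discrete Choquet integral of $\mathbf{x}\in\mathbb{R}^n$ with respect to $\nu$ is $C_\nu(\mathbf{x}):=\sum_{i=1}^n p_i^{\nu,\sigma}\,x_{\sigma(i)}$, where $\sigma\in\mathfrak{S}_n$ is any permutation such that $x_{\sigma(1)}\geqslant\cdots\geqslant x_{\sigma(n)}$ (the value does not depend on the choice of such $\sigma$). Empty products equal $1$. *)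

theory Defs
  imports "HOL-Probability.Probability" "HOL-Combinatorics.Permutations"
begin

text \<open>The players are the natural numbers \<open>1, \<dots>, n\<close>. The values of \<open>\<nu>\<close> on sets that are
  not contained in \<open>{1..n}\<close>, and those of a vector \<open>x\<close> outside \<open>{1..n}\<close>, are never used.\<close>

definition is_game :: "nat \<Rightarrow> (nat set \<Rightarrow> real) \<Rightarrow> bool" where
  "is_game n \<nu> \<longleftrightarrow> \<nu> {} = 0 \<and> (\<forall>S\<subseteq>{1..n}. 0 \<le> \<nu> S \<and> \<nu> S \<le> 1)"

definition chain_val :: "(nat set \<Rightarrow> real) \<Rightarrow> (nat \<Rightarrow> nat) \<Rightarrow> nat \<Rightarrow> real" where
  "chain_val \<nu> \<sigma> i = \<nu> (\<sigma> ` {1..i})"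

definition chain_inc :: "(nat set \<Rightarrow> real) \<Rightarrow> (nat \<Rightarrow> nat) \<Rightarrow> nat \<Rightarrow> real" where
  "chain_inc \<nu> \<sigma> i = chain_val \<nu> \<sigma> i - chain_val \<nu> \<sigma> (i - 1)"

definition sorting_perm :: "nat \<Rightarrow> (nat \<Rightarrow> real) \<Rightarrow> (nat \<Rightarrow> nat) \<Rightarrow> bool" where
  "sorting_perm n x \<sigma> \<longleftrightarrow>
     \<sigma> permutes {1..n} \<and> (\<forall>i\<in>{1..n}. \<forall>j\<in>{1..n}. i \<le> j \<longrightarrow> x (\<sigma> j) \<le> x (\<sigma> i))"

text \<open>The choice of the sorting permutation is immaterial: see \<open>sorting_perm_exists\<close> and
  \<open>choquet_eq\<close> below.\<close>

definition choquet :: "nat \<Rightarrow> (nat set \<Rightarrow> real) \<Rightarrow> (nat \<Rightarrow> real) \<Rightarrow> real" where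
  "choquet n \<nu> x =
     (let \<sigma> = (SOME \<sigma>. sorting_perm n x \<sigma>) in \<Sum>i = 1..n. chain_inc \<nu> \<sigma> i * x (\<sigma> i))"

lemma sorting_perm_exists: "\<exists>\<sigma>. sorting_perm n x \<sigma>"
proof -
  define xs where "xs = sort_key (\<lambda>i. - x i) [1..<Suc n]"
  have len: "length xs = n" and set: "set xs = {1..n}" and dist: "distinct xs"
    and srt: "sorted (map (\<lambda>i. - x i) xs)"
    unfolding xs_def by auto
  define \<sigma> where "\<sigma> i = (if i \<in> {1..n} then xs ! (i - 1) else i)" for i
  have inj: "inj_on \<sigma> {1..n}"
    by (rule inj_onI) (auto simp: \<sigma>_def len nth_eq_iff_index_eq[OF dist])
  have "\<sigma> i \<in> {1..n}" if "i \<in> {1..n}" for i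
    using that nth_mem[of "i - 1" xs] by (auto simp: \<sigma>_def len set)
  hence "\<sigma> ` {1..n} \<subseteq> {1..n}" by blast
  hence "bij_betw \<sigma> {1..n} {1..n}"
    using inj by (simp add: bij_betw_def endo_inj_surj)
  hence "\<sigma> permutes {1..n}"
    by (rule bij_imp_permutes) (auto simp: \<sigma>_def)
  moreover have "x (\<sigma> j) \<le> x (\<sigma> i)" if "i \<in> {1..n}" "j \<in> {1..n}" "i \<le> j" for i j
  proof -
    have "map (\<lambda>i. - x i) xs ! (i - 1) \<le> map (\<lambda>i. - x i) xs ! (j - 1)"
      using that by (intro sorted_nth_mono[OF srt]) (auto simp: len)
    thus ?thesis using that by (auto simp: \<sigma>_def len)
  qed
  ultimately show ?thesis unfolding sorting_perm_def by blast
qed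

lemma sorting_perm_le:
  assumes s: "sorting_perm n x \<sigma>" and t: "sorting_perm n x \<tau>" and i: "i \<in> {1..n}"
  shows "x (\<tau> i) \<le> x (\<sigma> i)"
proof (rule ccontr)
  assume less: "\<not> x (\<tau> i) \<le> x (\<sigma> i)"
  have ps: "\<sigma> permutes {1..n}" and pt: "\<tau> permutes {1..n}"
    using s t by (auto simp: sorting_perm_def)
  have "\<tau> ` {1..i} \<subseteq> \<sigma> ` {1..<i}"
  proof
    fix y assume "y \<in> \<tau> ` {1..i}"
    then obtain k where k: "k \<in> {1..i}" "y = \<tau> k" by blast
    have "x (\<tau> i) \<le> x y" and "y \<in> {1..n}"
      using t k i permutes_in_image[OF pt, of k] by (auto simp: sorting_perm_def)
    then obtain l where l: "l \<in> {1..n}" "y = \<sigma> l"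
      using permutes_image[OF ps] by blast
    have "l < i"
    proof (rule ccontr)
      assume "\<not> l < i"
      hence "x (\<sigma> l) \<le> x (\<sigma> i)"
        using s l(1) i by (auto simp: sorting_perm_def)
      thus False using less \<open>x (\<tau> i) \<le> x y\<close> l(2) by simp
    qed
    thus "y \<in> \<sigma> ` {1..<i}" using l by auto
  qed
  hence "card (\<tau> ` {1..i}) \<le> card (\<sigma> ` {1..<i})"
    by (intro card_mono) auto
  also have "\<dots> \<le> i - 1"
    using card_image_le[of "{1..<i}" \<sigma>] by simp
  also have "card (\<tau> ` {1..i}) = i"
    using permutes_inj_on[OF pt] by (simp add: card_image)
  finally show False using i by auto
qed

lemma sorting_perm_upper:
  assumes s: "sorting_perm n x \<sigma>" and i: "1 \<le> i" "i < n"
    and less: "x (\<sigma> (Suc i)) < x (\<sigma> i)"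
  shows "\<sigma> ` {1..i} = {j \<in> {1..n}. x (\<sigma> i) \<le> x j}"
proof -
  have ps: "\<sigma> permutes {1..n}"
    using s by (auto simp: sorting_perm_def)
  show ?thesis
  proof (intro equalityI subsetI)
    fix j assume "j \<in> \<sigma> ` {1..i}"
    then obtain k where "k \<in> {1..i}" "j = \<sigma> k" by blast
    thus "j \<in> {j \<in> {1..n}. x (\<sigma> i) \<le> x j}"
      using s i permutes_in_image[OF ps, of k] by (auto simp: sorting_perm_def)
  next
    fix j assume j: "j \<in> {j \<in> {1..n}. x (\<sigma> i) \<le> x j}"
    then obtain k where k: "k \<in> {1..n}" "j = \<sigma> k"
      using permutes_image[OF ps] by blast
    have "k \<le> i"
    proof (rule ccontr)
      assume "\<not> k \<le> i"
      hence "x (\<sigma> k) \<le> x (\<sigma> (Suc i))"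
        using s k(1) i by (auto simp: sorting_perm_def)
      thus False using less j k(2) by simp
    qed
    thus "j \<in> \<sigma> ` {1..i}" using k by auto
  qed
qed

lemma choquet_eq:
  assumes s: "sorting_perm n x \<sigma>"
  shows "choquet n \<nu> x = (\<Sum>i = 1..n. chain_inc \<nu> \<sigma> i * x (\<sigma> i))"
proof -
  define \<tau> where "\<tau> = (SOME \<sigma>. sorting_perm n x \<sigma>)"
  have t: "sorting_perm n x \<tau>"
    unfolding \<tau>_def by (rule someI_ex[OF sorting_perm_exists])
  have eq: "x (\<tau> i) = x (\<sigma> i)" if "i \<in> {1..n}" for i
    using sorting_perm_le[OF s t that] sorting_perm_le[OF t s that] by simp
  define d where "d i = chain_val \<nu> \<tau> i - chain_val \<nu> \<sigma> i" for i
  have step: "d m * x (\<sigma> m) = d m * x (\<sigma> (Suc m))" if m: "1 \<le> m" "m < n" for m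
  proof (cases "x (\<sigma> (Suc m)) < x (\<sigma> m)")
    case True
    moreover have "x (\<tau> (Suc m)) < x (\<tau> m)"
      using True m eq[of m] eq[of "Suc m"] by simp
    ultimately have "\<tau> ` {1..m} = \<sigma> ` {1..m}"
      using sorting_perm_upper[OF s m] sorting_perm_upper[OF t m] eq[of m] m by simp
    thus ?thesis by (simp add: d_def chain_val_def)
  next
    case False
    moreover have "x (\<sigma> (Suc m)) \<le> x (\<sigma> m)"
      using s m by (auto simp: sorting_perm_def)
    ultimately show ?thesis by simp
  qed
  have d0: "d 0 = 0" by (simp add: d_def chain_val_def)
  have "(\<Sum>i = 1..m. (d i - d (i - 1)) * x (\<sigma> i)) = d m * x (\<sigma> m)" if "m \<le> n" for m
    using that
  proof (induction m)
    case 0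
    show ?case by (simp add: d0)
  next
    case (Suc m)
    have "d m * x (\<sigma> m) = d m * x (\<sigma> (Suc m))"
      using step[of m] d0 Suc.prems by (cases "m = 0") auto
    thus ?case using Suc by (simp add: algebra_simps)
  qed
  from this[of n] have "(\<Sum>i = 1..n. (d i - d (i - 1)) * x (\<sigma> i)) = d n * x (\<sigma> n)"
    by simp
  also have "d n = 0"
    using s t by (auto simp: d_def chain_val_def sorting_perm_def permutes_image)
  finally have "(\<Sum>i = 1..n. chain_inc \<nu> \<tau> i * x (\<sigma> i)) = (\<Sum>i = 1..n. chain_inc \<nu> \<sigma> i * x (\<sigma> i))"
    by (simp add: d_def chain_inc_def algebra_simps sum_subtractf sum.distrib)
  moreover have "choquet n \<nu> x = (\<Sum>i = 1..n. chain_inc \<nu> \<tau> i * x (\<sigma> i))"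
    unfolding choquet_def Let_def \<tau>_def[symmetric] by (intro sum.cong) (auto simp: eq)
  ultimately show ?thesis by simp
qed

end

theory Submission
  imports Defs
begin

text \<open>On the event that \<open>\<sigma>\<close> sorts the sample, the Choquet integral equals
  \<open>\<Sum>i. (\<nu>\<^sub>i / i) * (i * (x (\<sigma> i) - x (\<sigma> (i + 1))))\<close>, where \<open>x (\<sigma> (n + 1))\<close> is read as 0.
  Given this event, which has probability \<open>1 / n!\<close>, the normalised spacings
  \<open>i * (x (\<sigma> i) - x (\<sigma> (i + 1)))\<close> are independent standard exponentials. So the law is the average over \<open>\<sigma>\<close> of the laws of
  \<open>\<Sum>i. \<nu>\<^sub>i / i * Z i\<close>, which are hypoexponential; their densities follow by convolution,
  with the last coefficient supplied by the vanishing of a divided difference. Ties need no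
  separate treatment: summing over all weakly sorting \<open>\<sigma>\<close> bounds the law from above by
  a measure of total mass 1, hence the two agree.\<close>

section \<open>Divided differences of powers\<close>

text \<open>The factor \<open>a i - a q\<close> annihilates the term \<open>i = q\<close> and
  cancels the factor \<open>k = q\<close> in every other denominator. Both inductions below delete a
  node in this way.\<close>

lemma sum_mult_diff_div_prod_diff:
  fixes a c :: "'b \<Rightarrow> 'c :: field"
  assumes "finite S" "inj_on a S" "q \<in> S"
  shows "(\<Sum>i\<in>S. c i * (a i - a q) / (\<Prod>k\<in>S - {i}. a i - a k)) =
         (\<Sum>i\<in>S - {q}. c i / (\<Prod>k\<in>S - {q} - {i}. a i - a k))"
proof -
  have "(\<Sum>i\<in>S. c i * (a i - a q) / (\<Prod>k\<in>S - {i}. a i - a k)) =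
        (\<Sum>i\<in>S - {q}. c i * (a i - a q) / (\<Prod>k\<in>S - {i}. a i - a k))"
    using assms by (simp add: sum.remove[of S q])
  also have "\<dots> = (\<Sum>i\<in>S - {q}. c i / (\<Prod>k\<in>S - {q} - {i}. a i - a k))"
  proof (rule sum.cong[OF refl])
    fix i assume i: "i \<in> S - {q}"
    have "(\<Prod>k\<in>S - {i}. a i - a k) = (a i - a q) * (\<Prod>k\<in>S - {i} - {q}. a i - a k)"
      using assms i by (intro prod.remove) auto
    moreover have "S - {i} - {q} = S - {q} - {i}" by blast
    moreover have "a i - a q \<noteq> 0" using assms i by (auto simp: inj_on_def)
    ultimately show "c i * (a i - a q) / (\<Prod>k\<in>S - {i}. a i - a k) =
          c i / (\<Prod>k\<in>S - {q} - {i}. a i - a k)"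
      by simp
  qed
  finally show ?thesis .
qed

text \<open>The sum is the divided difference of \<open>x ^ m\<close> at the nodes \<open>a i\<close>.\<close>

lemma sum_power_div_prod_diff_eq_0:
  fixes a :: "'b \<Rightarrow> 'c :: field"
  assumes "finite S" "inj_on a S" "m + 2 \<le> card S"
  shows "(\<Sum>i\<in>S. a i ^ m / (\<Prod>k\<in>S - {i}. a i - a k)) = 0"
  using assms
proof (induction m arbitrary: S)
  case 0
  thus ?case
  \<comment> \<open>Exponent 0 has its own induction, on the number of nodes.\<close>
  proof (induction "card S" arbitrary: S rule: less_induct)
    case less
    then obtain p q where pq: "p \<in> S" "q \<in> S" "p \<noteq> q"
      by (metis card_le_Suc0_iff_eq not_less_eq_eq numeral_2_eq_2 plus_nat.add_0)
    let ?D = "\<lambda>S. \<Sum>i\<in>S. 1 / (\<Prod>k\<in>S - {i}. a i - a k)"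
    have rec: "?D (S - {r}) = (\<Sum>i\<in>S. (a i - a r) / (\<Prod>k\<in>S - {i}. a i - a k))" if "r \<in> S" for r
      using sum_mult_diff_div_prod_diff[OF less.prems(1,2) that, of "\<lambda>_. 1"] by simp
    \<comment> \<open>Writing \<open>a p - a q\<close> as \<open>(a i - a q) - (a i - a p)\<close>
      in each term reduces the sum to the two node sets with \<open>q\<close> or \<open>p\<close>
      deleted.\<close>
    have eq: "(a p - a q) * ?D S = ?D (S - {q}) - ?D (S - {p})"
      unfolding rec[OF pq(1)] rec[OF pq(2)]
      by (simp add: sum_distrib_left sum_subtractf[symmetric] diff_divide_distrib[symmetric])
    have "?D (S - {q}) = ?D (S - {p})"
    \<comment> \<open>Two nodes leave singletons, where both sums are 1 because the product is
      empty; with more nodes both smaller sums vanish by induction.\<close>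
    proof (cases "card S = 2")
      case True
      hence "S = {p, q}" using pq less.prems(1)
        by (metis card_2_iff' card_2_iff doubleton_eq_iff insertE singletonD)
      hence "S - {q} = {p}" "S - {p} = {q}" using pq by auto
      thus ?thesis by simp
    next
      case False
      hence "?D (S - {r}) = 0" if "r \<in> S" for r
        using less.hyps[of "S - {r}"] less.prems that
        by (auto simp: card_gt_0_iff inj_on_diff)
      thus ?thesis using pq by simp
    qed
    moreover have "a p - a q \<noteq> 0" using pq less.prems by (auto simp: inj_on_def)
    ultimately show ?case using eq by simp
  qed
next
  case (Suc m)
  then obtain q where q: "q \<in> S" by fastforce
  have "(\<Sum>i\<in>S - {q}. a i ^ m / (\<Prod>k\<in>S - {q} - {i}. a i - a k)) = 0"
    using Suc.IH[of "S - {q}"] Suc.prems q by (auto simp: inj_on_diff)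
  hence "(\<Sum>i\<in>S. a i ^ m * (a i - a q) / (\<Prod>k\<in>S - {i}. a i - a k)) = 0"
    using sum_mult_diff_div_prod_diff[OF Suc.prems(1,2) q, of "\<lambda>i. a i ^ m"] by simp
  moreover have "(\<Sum>i\<in>S. a i ^ m / (\<Prod>k\<in>S - {i}. a i - a k)) = 0"
    using Suc by simp
  \<comment> \<open>Split \<open>a i ^ Suc m\<close> as
    \<open>a i ^ m * (a i - a q) + a q * a i ^ m\<close>: the induction hypothesis kills the first
    part on the nodes without \<open>q\<close> and the second on all of \<open>S\<close>.\<close>
  ultimately have "0 = (\<Sum>i\<in>S. a i ^ m * (a i - a q) / (\<Prod>k\<in>S - {i}. a i - a k)) +
       a q * (\<Sum>i\<in>S. a i ^ m / (\<Prod>k\<in>S - {i}. a i - a k))" by simp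
  also have "\<dots> = (\<Sum>i\<in>S. a i ^ Suc m / (\<Prod>k\<in>S - {i}. a i - a k))"
    unfolding sum_distrib_left sum.distrib[symmetric]
    by (intro sum.cong) (simp_all add: algebra_simps add_divide_distrib[symmetric])
  finally show ?case by simp
qed

section \<open>Hypoexponential densities and expectations\<close>

text \<open>The partial-fraction form, for \<open>y\<close> \<ge> 0, of the density of a sum of
  independent exponentials with distinct means \<open>a i\<close> > 0. The integer power covers
  \<open>n = 1\<close>, where the exponent is -1.\<close>

definition hypoexp_density :: "(nat \<Rightarrow> real) \<Rightarrow> nat \<Rightarrow> real \<Rightarrow> real" where
  "hypoexp_density a n y =
     (\<Sum>i = 1..n. a i powi (int n - 2) / (\<Prod>k\<in>{1..n} - {i}. a i - a k) * exp (- y / a i))"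

lemma borel_measurable_hypoexp_density [measurable]: "hypoexp_density a n \<in> borel_measurable borel"
  unfolding hypoexp_density_def by measurable

lemma hypoexp_density_1: "0 < a 1 \<Longrightarrow> hypoexp_density a 1 y = exp (- y / a 1) / a 1"
  by (simp add: hypoexp_density_def power_int_def field_simps)

text \<open>This is the form in which the convolution integral produces the density. For
  \<open>i\<close> \<le> \<open>n\<close> the new factor \<open>a i - a (Suc n)\<close> is split off
  the product; the coefficient of the last exponential is minus the sum of the others.\<close>

lemma hypoexp_density_Suc:
  assumes n: "1 \<le> n" and pos: "\<And>i. i \<in> {1..Suc n} \<Longrightarrow> 0 < a i" and inj: "inj_on a {1..Suc n}"
  shows "hypoexp_density a (Suc n) y =
    (\<Sum>i = 1..n. a i powi (int n - 2) / (\<Prod>k\<in>{1..n} - {i}. a i - a k) *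
       (a i / (a i - a (Suc n)) * (exp (- y / a i) - exp (- y / a (Suc n)))))"
proof -
  let ?P = "\<lambda>i. \<Prod>k\<in>{1..Suc n} - {i}. a i - a k"
  have coeff: "a i powi (int n - 2) / (\<Prod>k\<in>{1..n} - {i}. a i - a k) * (a i / (a i - a (Suc n))) =
      a i ^ (n - 1) / ?P i" if i: "i \<in> {1..n}" for i
  proof -
    have "{1..Suc n} - {i} = insert (Suc n) ({1..n} - {i})" using i by auto
    hence "?P i = (a i - a (Suc n)) * (\<Prod>k\<in>{1..n} - {i}. a i - a k)" by simp
    moreover have "a i powi (int n - 2) * a i = a i ^ (n - 1)"
    proof -
      have "a i powi (int n - 2) * a i = a i powi (int n - 2 + 1)"
        using pos[of i] i by (subst power_int_add) auto
      also have "int n - 2 + 1 = int (n - 1)" using n by auto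
      finally show ?thesis by simp
    qed
    ultimately show ?thesis by (simp add: field_simps)
  qed
  \<comment> \<open>There are \<open>n + 1\<close> nodes and the exponent is \<open>n - 1\<close>,
    the largest one for which the divided difference is known to vanish.\<close>
  have "(\<Sum>i\<in>{1..Suc n}. a i ^ (n - 1) / ?P i) = 0"
    using n by (intro sum_power_div_prod_diff_eq_0 inj) auto
  hence last: "a (Suc n) ^ (n - 1) / ?P (Suc n) = - (\<Sum>i = 1..n. a i ^ (n - 1) / ?P i)"
    by simp
  have e: "int (Suc n) - 2 = int (n - 1)" using n by simp
  have "hypoexp_density a (Suc n) y =
      (\<Sum>i = 1..n. a i ^ (n - 1) / ?P i * exp (- y / a i)) +
      a (Suc n) ^ (n - 1) / ?P (Suc n) * exp (- y / a (Suc n))"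
    unfolding hypoexp_density_def e power_int_of_nat sum.cl_ivl_Suc by simp
  also have "\<dots> = (\<Sum>i = 1..n. a i ^ (n - 1) / ?P i * (exp (- y / a i) - exp (- y / a (Suc n))))"
    unfolding last by (simp add: right_diff_distrib sum_subtractf sum_distrib_right)
  also have "\<dots> = (\<Sum>i = 1..n. a i powi (int n - 2) / (\<Prod>k\<in>{1..n} - {i}. a i - a k) *
       (a i / (a i - a (Suc n)) * (exp (- y / a i) - exp (- y / a (Suc n)))))"
    by (intro sum.cong refl) (simp only: coeff[symmetric] mult.assoc)
  finally show ?thesis .
qed

text \<open>With \<open>u\<close> the value of the last exponential, the integrand has an elementary
  antiderivative, and the upper limit is where \<open>w - a (Suc n) * u\<close> reaches 0. The
  antiderivative is nondecreasing up to there, so nonnegativity passes to the next density.\<close>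

lemma hypoexp_density_convolution:
  assumes n: "1 \<le> n" and pos: "\<And>i. i \<in> {1..Suc n} \<Longrightarrow> 0 < a i" and inj: "inj_on a {1..Suc n}"
    and nonneg: "\<And>y. 0 \<le> y \<Longrightarrow> 0 \<le> hypoexp_density a n y" and w: "0 \<le> w"
  shows "0 \<le> hypoexp_density a (Suc n) w" (is ?nonneg)
    and "(\<integral>\<^sup>+u. ennreal (exp (- u) * hypoexp_density a n (w - a (Suc n) * u)) *
            indicator {0..w / a (Suc n)} u \<partial>lborel) = ennreal (hypoexp_density a (Suc n) w)" (is ?eq)
proof -
  let ?b = "a (Suc n)"
  have b: "0 < ?b" using pos by simp
  define C where "C i = a i powi (int n - 2) / (\<Prod>k\<in>{1..n} - {i}. a i - a k)" for i
  \<comment> \<open>Each exponent is linear in \<open>u\<close> with slope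
    \<open>?b / a i - 1\<close>, and \<open>a i / (?b - a i)\<close> is the reciprocal of that
    slope; injectivity of \<open>a\<close> makes it nonzero.\<close>
  define F where "F u = (\<Sum>i = 1..n. C i * (a i / (?b - a i) * exp (- u - (w - ?b * u) / a i)))" for u
  define f where "f u = exp (- u) * hypoexp_density a n (w - ?b * u)" for u
  have f_nonneg: "0 \<le> f u" if "0 \<le> u" "u \<le> w / ?b" for u
    using that b unfolding f_def by (intro mult_nonneg_nonneg nonneg) (auto simp: field_simps)
  have deriv: "DERIV F u :> f u" for u
  proof -
    have "DERIV (\<lambda>u. C i * (a i / (?b - a i) * exp (- u - (w - ?b * u) / a i))) u :>
        exp (- u) * (C i * exp (- (w - ?b * u) / a i))" if i: "i \<in> {1..n}" for i
    proof -
      have ai: "0 < a i" and ne: "?b - a i \<noteq> 0" using pos[of i] i inj_onD[OF inj, of "Suc n" i] by auto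
      have one: "a i / (?b - a i) * (?b / a i - 1) = 1" using ai ne by (simp add: field_simps)
      have "C i * (a i / (?b - a i) * (exp (- u - (w - ?b * u) / a i) * (?b / a i - 1))) =
          (a i / (?b - a i) * (?b / a i - 1)) * (C i * exp (- u - (w - ?b * u) / a i))"
        by (simp only: ac_simps)
      also have "\<dots> = C i * exp (- u - (w - ?b * u) / a i)"
        unfolding one by simp
      also have "\<dots> = exp (- u) * (C i * exp (- (w - ?b * u) / a i))"
      proof -
        have "exp (- u - (w - ?b * u) / a i) = exp (- u) * exp (- (w - ?b * u) / a i)"
          by (simp add: exp_add[symmetric] diff_divide_distrib)
        thus ?thesis by (simp only: ac_simps)
      qed
      finally have eq: "C i * (a i / (?b - a i) * (exp (- u - (w - ?b * u) / a i) * (?b / a i - 1))) =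
          exp (- u) * (C i * exp (- (w - ?b * u) / a i))" .
      have "DERIV (\<lambda>u. - u - (w - ?b * u) / a i) u :> ?b / a i - 1"
        using ai by (auto intro!: derivative_eq_intros simp: field_simps)
      thus ?thesis unfolding eq[symmetric] by (intro DERIV_cmult DERIV_fun_exp)
    qed
    thus ?thesis unfolding F_def[abs_def] f_def hypoexp_density_def sum_distrib_left C_def[symmetric]
      by (intro DERIV_sum) auto
  qed
  have h: "hypoexp_density a (Suc n) w =
      (\<Sum>i = 1..n. C i * (a i / (a i - ?b) * (exp (- w / a i) - exp (- w / ?b))))"
    unfolding C_def by (rule hypoexp_density_Suc[OF n pos inj])
  \<comment> \<open>The exponents are \<open>- w / ?b\<close> at the upper end and
    \<open>- w / a i\<close> at 0; the sign is absorbed by reversing the difference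
    \<open>?b - a i\<close>.\<close>
  have F0: "F (w / ?b) - F 0 = hypoexp_density a (Suc n) w"
    unfolding F_def h sum_subtractf[symmetric]
  proof (intro sum.cong refl)
    fix i
    have "a i / (a i - ?b) = - (a i / (?b - a i))"
      by (metis minus_diff_eq minus_divide_right)
    moreover have "w - ?b * (w / ?b) = 0" using b by simp
    ultimately show "C i * (a i / (?b - a i) * exp (- (w / ?b) - (w - ?b * (w / ?b)) / a i)) -
         C i * (a i / (?b - a i) * exp (- 0 - (w - ?b * 0) / a i)) =
         C i * (a i / (a i - ?b) * (exp (- w / a i) - exp (- w / ?b)))"
      by (simp only:) (simp add: right_diff_distrib)
  qed
  have le: "0 \<le> w / ?b" using w b by simp
  have "F 0 \<le> F (w / ?b)"
    using le by (rule DERIV_nonneg_imp_nondecreasing) (use deriv f_nonneg in blast)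
  thus ?nonneg using F0 by simp
  have "(\<integral>\<^sup>+u. ennreal (f u) * indicator {0..w / ?b} u \<partial>lborel) = ennreal (F (w / ?b) - F 0)"
  proof (rule nn_integral_FTC_Icc[OF _ deriv f_nonneg le])
    show "f \<in> borel_measurable borel" unfolding f_def[abs_def] by measurable
  qed auto
  thus ?eq unfolding F0 f_def .
qed

text \<open>The expectation of \<open>g (c + (\<Sum>i = 1..n. a i * Z i))\<close> for independent standard
  exponential \<open>Z i\<close>.\<close>

primrec hypoexp_nn_integral :: "(real \<Rightarrow> ennreal) \<Rightarrow> (nat \<Rightarrow> real) \<Rightarrow> nat \<Rightarrow> real \<Rightarrow> ennreal" where
  "hypoexp_nn_integral g a 0 c = g c"
| "hypoexp_nn_integral g a (Suc n) c =
     (\<integral>\<^sup>+u. ennreal (exponential_density 1 u) * hypoexp_nn_integral g a n (c + a (Suc n) * u) \<partial>lborel)"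

lemma borel_measurable_hypoexp_nn_integral [measurable]:
  assumes [measurable]: "g \<in> borel_measurable borel"
  shows "hypoexp_nn_integral g a n \<in> borel_measurable borel"
proof (induction n)
  case 0
  show ?case using assms by (simp add: hypoexp_nn_integral.simps(1)[abs_def])
next
  case (Suc n)
  note [measurable] = Suc
  show ?case unfolding hypoexp_nn_integral.simps(2)[abs_def] by measurable
qed

lemma nn_integral_exponential_density: "(\<integral>\<^sup>+u. ennreal (exponential_density 1 u) \<partial>lborel) = 1"
  using prob_space.emeasure_space_1[OF prob_space_exponential_density[of 1]]
  by (simp add: emeasure_density)

text \<open>Each integration averages a constant against a probability density. This later gives the
  total mass of the candidate density without integrating its formula.\<close>

lemma hypoexp_nn_integral_1: "hypoexp_nn_integral (\<lambda>_. 1) a n c = 1"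
  by (induction n arbitrary: c) (simp_all add: nn_integral_exponential_density)

text \<open>One exponential is a rescaling by \<open>a 1\<close>; a further one is added by Tonelli
  and the convolution lemma. Nonnegativity is part of the induction because \<open>ennreal\<close>
  sends negative values to 0.\<close>

lemma hypoexp_nn_integral_eq:
  assumes [measurable]: "g \<in> borel_measurable borel" and n: "1 \<le> n"
    and pos: "\<And>i. i \<in> {1..n} \<Longrightarrow> 0 < a i" and inj: "inj_on a {1..n}"
  shows "(\<forall>y\<ge>0. 0 \<le> hypoexp_density a n y) \<and> (\<forall>c. hypoexp_nn_integral g a n c =
    (\<integral>\<^sup>+y. ennreal (hypoexp_density a n y) * indicator {0..} y * g (c + y) \<partial>lborel))"
  using n pos inj
proof (induction n rule: nat_induct_at_least)
  case base
  hence a: "0 < a 1" by simp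
  have "hypoexp_nn_integral g a 1 c =
      (\<integral>\<^sup>+y. ennreal (hypoexp_density a 1 y) * indicator {0..} y * g (c + y) \<partial>lborel)" for c
  proof -
    have "(\<integral>\<^sup>+y. ennreal (hypoexp_density a 1 y) * indicator {0..} y * g (c + y) \<partial>lborel) =
       ennreal (a 1) * (\<integral>\<^sup>+u. ennreal (hypoexp_density a 1 (a 1 * u)) * indicator {0..} (a 1 * u) *
          g (c + a 1 * u) \<partial>lborel)"
      using a by (subst nn_integral_real_affine[where c = "a 1" and t = 0]) auto
    also have "\<dots> = (\<integral>\<^sup>+u. ennreal (a 1) * (ennreal (hypoexp_density a 1 (a 1 * u)) *
          indicator {0..} (a 1 * u) * g (c + a 1 * u)) \<partial>lborel)"
      by (rule nn_integral_cmult[symmetric]) measurable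
    also have "\<dots> = (\<integral>\<^sup>+u. ennreal (exponential_density 1 u) * g (c + a 1 * u) \<partial>lborel)"
    proof (rule nn_integral_cong)
      fix u
      have "ennreal (a 1) * ennreal (hypoexp_density a 1 (a 1 * u)) = ennreal (exp (- u))"
        unfolding hypoexp_density_1[of a, OF a] using a by (simp add: ennreal_mult[symmetric])
      moreover have "(indicator {0..} (a 1 * u) :: ennreal) = indicator {0..} u"
        using a by (auto simp: indicator_def zero_le_mult_iff)
      ultimately show "ennreal (a 1) * (ennreal (hypoexp_density a 1 (a 1 * u)) *
          indicator {0..} (a 1 * u) * g (c + a 1 * u)) =
          ennreal (exponential_density 1 u) * g (c + a 1 * u)"
        by (simp add: mult.assoc[symmetric] exponential_density_def indicator_def)
    qed
    finally show ?thesis by simp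
  qed
  moreover have "0 \<le> hypoexp_density a 1 y" for y
    unfolding hypoexp_density_1[of a, OF a] using a by simp
  ultimately show ?case by blast
next
  case (Suc n)
  let ?b = "a (Suc n)" and ?h = "hypoexp_density a"
  have b: "0 < ?b" using Suc.prems by simp
  have inj: "inj_on a {1..n}" using Suc.prems(2) by (rule inj_on_subset) auto
  have nonneg: "0 \<le> ?h n y" if "0 \<le> y" for y
    using Suc.IH inj Suc.prems that by auto
  note conv = hypoexp_density_convolution[OF Suc.hyps Suc.prems nonneg]
  have "hypoexp_nn_integral g a (Suc n) c =
      (\<integral>\<^sup>+y. ennreal (?h (Suc n) y) * indicator {0..} y * g (c + y) \<partial>lborel)" for c
  proof -
    have "hypoexp_nn_integral g a (Suc n) c = (\<integral>\<^sup>+u. ennreal (exponential_density 1 u) *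
        (\<integral>\<^sup>+y. ennreal (?h n y) * indicator {0..} y * g (c + ?b * u + y) \<partial>lborel) \<partial>lborel)"
      using Suc.IH inj Suc.prems by simp
    also have "\<dots> = (\<integral>\<^sup>+u. \<integral>\<^sup>+w. ennreal (exponential_density 1 u) *
        (ennreal (?h n (w - ?b * u)) * indicator {0..} (w - ?b * u) * g (c + w)) \<partial>lborel \<partial>lborel)"
    proof (rule nn_integral_cong)
      \<comment> \<open>Passing to the total \<open>w = y + ?b * u\<close> frees the argument of
        \<open>g\<close> from \<open>u\<close>, so that \<open>g\<close> becomes a constant factor
        once the integrals are exchanged.\<close>
      fix u
      have "(\<integral>\<^sup>+y. ennreal (?h n y) * indicator {0..} y * g (c + ?b * u + y) \<partial>lborel) =
          (\<integral>\<^sup>+w. ennreal (?h n (w - ?b * u)) * indicator {0..} (w - ?b * u) * g (c + w) \<partial>lborel)"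
        by (subst nn_integral_real_affine[where c = 1 and t = "- ?b * u"])
          (auto simp: algebra_simps)
      thus "ennreal (exponential_density 1 u) *
          (\<integral>\<^sup>+y. ennreal (?h n y) * indicator {0..} y * g (c + ?b * u + y) \<partial>lborel) =
          (\<integral>\<^sup>+w. ennreal (exponential_density 1 u) *
             (ennreal (?h n (w - ?b * u)) * indicator {0..} (w - ?b * u) * g (c + w)) \<partial>lborel)"
        by (simp add: nn_integral_cmult)
    qed
    also have "\<dots> = (\<integral>\<^sup>+w. \<integral>\<^sup>+u. ennreal (exponential_density 1 u) *
        (ennreal (?h n (w - ?b * u)) * indicator {0..} (w - ?b * u) * g (c + w)) \<partial>lborel \<partial>lborel)"
      by (rule lborel_pair.Fubini') measurable
    also have "\<dots> = (\<integral>\<^sup>+w. ennreal (?h (Suc n) w) * indicator {0..} w * g (c + w) \<partial>lborel)"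
    proof (rule nn_integral_cong)
      \<comment> \<open>The support conditions 0 \<le> \<open>u\<close> and \<open>?b * u\<close>
        \<le> \<open>w\<close> together leave exactly the interval of the convolution lemma.\<close>
      fix w
      have "(\<integral>\<^sup>+u. ennreal (exponential_density 1 u) *
          (ennreal (?h n (w - ?b * u)) * indicator {0..} (w - ?b * u) * g (c + w)) \<partial>lborel) =
          (\<integral>\<^sup>+u. (ennreal (exp (- u) * ?h n (w - ?b * u)) * indicator {0..w / ?b} u) * g (c + w) \<partial>lborel)"
        using b by (intro nn_integral_cong)
          (auto simp: exponential_density_def indicator_def ennreal_mult' field_simps mult_ac)
      also have "\<dots> = (\<integral>\<^sup>+u. ennreal (exp (- u) * ?h n (w - ?b * u)) * indicator {0..w / ?b} u \<partial>lborel) *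
          g (c + w)"
        by (rule nn_integral_multc) measurable
      also have "\<dots> = ennreal (?h (Suc n) w) * indicator {0..} w * g (c + w)"
      proof (cases "0 \<le> w")
        case True
        thus ?thesis using conv(2) by simp
      next
        case False
        hence "{0..w / ?b} = {}" using b by (auto simp: field_simps)
        thus ?thesis using False by simp
      qed
      finally show "(\<integral>\<^sup>+u. ennreal (exponential_density 1 u) *
          (ennreal (?h n (w - ?b * u)) * indicator {0..} (w - ?b * u) * g (c + w)) \<partial>lborel) =
          ennreal (?h (Suc n) w) * indicator {0..} w * g (c + w)" .
    qed
    finally show ?thesis .
  qed
  thus ?case using conv(1) by blast
qed

section \<open>Ordered exponential samples and their spacings\<close>

text \<open>The threshold \<open>t\<close> serves the induction on \<open>n\<close>: once the last,
  smallest coordinate is fixed, its value is the threshold for the remaining ones.\<close>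

definition descending_above :: "nat \<Rightarrow> real \<Rightarrow> (nat \<Rightarrow> real) \<Rightarrow> bool" where
  "descending_above n t z \<longleftrightarrow>
     (\<forall>i\<in>{1..n}. \<forall>j\<in>{1..n}. i \<le> j \<longrightarrow> z j \<le> z i) \<and> (\<forall>i\<in>{1..n}. t \<le> z i)"

lemma descending_above_Suc:
  "descending_above (Suc n) t (z(Suc n := y)) \<longleftrightarrow> t \<le> y \<and> descending_above n y z"
  (is "?L \<longleftrightarrow> ?R")
proof
  assume L: ?L
  have "t \<le> y"
    using L[unfolded descending_above_def, THEN conjunct2, rule_format, of "Suc n"] by simp
  moreover have "z j \<le> z i" if "i \<in> {1..n}" "j \<in> {1..n}" "i \<le> j" for i j
    using L[unfolded descending_above_def, THEN conjunct1, rule_format, of i j] that by auto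
  moreover have "y \<le> z i" if "i \<in> {1..n}" for i
    using L[unfolded descending_above_def, THEN conjunct1, rule_format, of i "Suc n"] that by auto
  ultimately show ?R unfolding descending_above_def by blast
next
  assume R: ?R
  have "(z(Suc n := y)) j \<le> (z(Suc n := y)) i"
    if "i \<in> {1..Suc n}" "j \<in> {1..Suc n}" "i \<le> j" for i j
    using R that unfolding descending_above_def by (cases "j = Suc n"; cases "i = Suc n") auto
  moreover have "t \<le> (z(Suc n := y)) i" if "i \<in> {1..Suc n}" for i
  proof (cases "i = Suc n")
    case False
    hence "y \<le> z i" using R that by (auto simp: descending_above_def)
    thus ?thesis using R False by simp
  qed (use R in simp)
  ultimately show ?L unfolding descending_above_def by blast
qed

abbreviation exponential_law :: "real measure" where
  "exponential_law \<equiv> density lborel (\<lambda>x. ennreal (exponential_density 1 x))"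

lemma prob_space_exponential_law: "prob_space exponential_law"
  by (rule prob_space_exponential_density) simp

lemma measurable_descending_above [measurable]:
  "Measurable.pred (\<Pi>\<^sub>M i\<in>{1..n}. exponential_law) (descending_above n t)"
proof -
  let ?P = "\<Pi>\<^sub>M i\<in>{1..n}. exponential_law"
  have m: "(\<lambda>z. z i) \<in> borel_measurable ?P" if "i \<in> {1..n}" for i
    using that by measurable
  have "Measurable.pred ?P (\<lambda>z. i \<le> j \<longrightarrow> z j \<le> z i)" if "i \<in> {1..n}" "j \<in> {1..n}" for i j
    unfolding Measurable.pred_def using borel_measurable_le[OF m[OF that(2)] m[OF that(1)]]
    by (cases "i \<le> j") auto
  moreover have "Measurable.pred ?P (\<lambda>z. t \<le> z i)" if "i \<in> {1..n}" for i
    unfolding Measurable.pred_def by (rule borel_measurable_le[OF _ m[OF that]]) simp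
  ultimately show ?thesis
    unfolding descending_above_def
    by (intro pred_intros_logic(3) pred_intros_finite(3) finite_atLeastAtMost)
qed

text \<open>Memorylessness: beyond \<open>t\<close>, an exponential variable of rate
  \<open>m\<close> exceeds \<open>t\<close> by \<open>u / m\<close> with \<open>u\<close> standard
  exponential. The proof is the substitution \<open>y = t + u / m\<close>.\<close>

lemma nn_integral_exp_tail:
  assumes [measurable]: "G \<in> borel_measurable borel" and m: "0 < m"
  shows "(\<integral>\<^sup>+y. ennreal (exp (- m * y)) * indicator {t..} y * G y \<partial>lborel) =
         ennreal (exp (- m * t) / m) *
           (\<integral>\<^sup>+u. ennreal (exponential_density 1 u) * G (t + u / m) \<partial>lborel)"
proof -
  have "(\<integral>\<^sup>+y. ennreal (exp (- m * y)) * indicator {t..} y * G y \<partial>lborel) =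
      ennreal (1 / m) * (\<integral>\<^sup>+u. ennreal (exp (- m * (t + 1 / m * u))) *
        indicator {t..} (t + 1 / m * u) * G (t + 1 / m * u) \<partial>lborel)"
    using m by (subst nn_integral_real_affine[where c = "1 / m" and t = t]) auto
  also have "\<dots> = ennreal (1 / m) * (\<integral>\<^sup>+u. ennreal (exp (- m * t)) *
      (ennreal (exponential_density 1 u) * G (t + u / m)) \<partial>lborel)"
  proof (rule arg_cong[where f = "\<lambda>I. ennreal (1 / m) * I"], rule nn_integral_cong)
    fix u
    have "- m * (t + 1 / m * u) = - m * t + - u" using m by (simp add: distrib_left)
    hence "exp (- m * (t + 1 / m * u)) = exp (- m * t) * exp (- u)" by (simp only: exp_add)
    hence "ennreal (exp (- m * (t + 1 / m * u))) = ennreal (exp (- m * t)) * ennreal (exp (- u))"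
      by (simp add: ennreal_mult)
    thus "ennreal (exp (- m * (t + 1 / m * u))) * indicator {t..} (t + 1 / m * u) *
        G (t + 1 / m * u) = ennreal (exp (- m * t)) * (ennreal (exponential_density 1 u) * G (t + u / m))"
      using m by (cases "0 \<le> u") (simp_all add: exponential_density_def mult.assoc zero_le_divide_iff)
  qed
  also have "\<dots> = ennreal (1 / m) * (ennreal (exp (- m * t)) *
      (\<integral>\<^sup>+u. ennreal (exponential_density 1 u) * G (t + u / m) \<partial>lborel))"
    by (subst nn_integral_cmult) auto
  also have "\<dots> = ennreal (exp (- m * t) / m) *
      (\<integral>\<^sup>+u. ennreal (exponential_density 1 u) * G (t + u / m) \<partial>lborel)"
    using m by (simp add: mult.assoc[symmetric] ennreal_mult[symmetric])
  finally show ?thesis .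
qed

text \<open>The smallest coordinate is integrated last. Given \<open>z (Suc n) = y\<close>, the induction
  hypothesis applies with \<open>y\<close> in place of \<open>t\<close>, and \<open>y = t + u / Suc n\<close> turns the weight
  \<open>exp (- Suc n * y)\<close> into the standard exponential density of \<open>u\<close>.\<close>

lemma nn_integral_descending_above:
  fixes b :: "nat \<Rightarrow> real"
  assumes [measurable]: "g \<in> borel_measurable borel" and b0: "b 0 = 0" and t: "0 \<le> t"
  shows "(\<integral>\<^sup>+z. of_bool (descending_above n t z) * g (c + (\<Sum>i = 1..n. (b i - b (i - 1)) * z i))
            \<partial>(\<Pi>\<^sub>M i\<in>{1..n}. exponential_law)) =
         ennreal (exp (- real n * t) / fact n) *
           hypoexp_nn_integral g (\<lambda>i. b i / real i) n (c + b n * t)"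
  using t
proof (induction n arbitrary: c t)
  case 0
  thus ?case by (simp add: PiM_empty nn_integral_count_space_finite descending_above_def b0)
next
  case (Suc n)
  interpret product_sigma_finite "\<lambda>i::nat. exponential_law"
    unfolding product_sigma_finite_def
    using prob_space_imp_sigma_finite[OF prob_space_exponential_law] by blast
  let ?H = "hypoexp_nn_integral g (\<lambda>i. b i / real i)" and ?m = "real (Suc n)"
  let ?P = "\<Pi>\<^sub>M i\<in>{1..n}. exponential_law"
  have ins: "{1..Suc n} = insert (Suc n) {1..n}" by auto
  have ms: "(\<lambda>z. of_bool (descending_above (Suc n) t z) *
      g (c + (\<Sum>i = 1..Suc n. (b i - b (i - 1)) * z i)))
      \<in> borel_measurable (\<Pi>\<^sub>M i\<in>{1..Suc n}. exponential_law)"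
    by measurable
  have "(\<integral>\<^sup>+z. of_bool (descending_above (Suc n) t z) *
      g (c + (\<Sum>i = 1..Suc n. (b i - b (i - 1)) * z i)) \<partial>(\<Pi>\<^sub>M i\<in>{1..Suc n}. exponential_law)) =
    (\<integral>\<^sup>+y. \<integral>\<^sup>+z. of_bool (descending_above (Suc n) t (z(Suc n := y))) *
      g (c + (\<Sum>i = 1..Suc n. (b i - b (i - 1)) * (z(Suc n := y)) i)) \<partial>?P \<partial>exponential_law)"
    unfolding ins by (rule product_nn_integral_insert_rev[OF _ _ ms[unfolded ins]]) simp_all
  also have "\<dots> = (\<integral>\<^sup>+y. indicator {t..} y * (\<integral>\<^sup>+z. of_bool (descending_above n y z) *
      g ((c + (b (Suc n) - b n) * y) + (\<Sum>i = 1..n. (b i - b (i - 1)) * z i)) \<partial>?P) \<partial>exponential_law)"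
  proof (rule nn_integral_cong)
    fix y
    have e: "(\<Sum>i = 1..Suc n. (b i - b (i - 1)) * (z(Suc n := y)) i) =
        (b (Suc n) - b n) * y + (\<Sum>i = 1..n. (b i - b (i - 1)) * z i)" for z
    proof -
      have "(\<Sum>i = 1..n. (b i - b (i - 1)) * (z(Suc n := y)) i) =
          (\<Sum>i = 1..n. (b i - b (i - 1)) * z i)"
        by (intro sum.cong) auto
      thus ?thesis by simp
    qed
    show "(\<integral>\<^sup>+z. of_bool (descending_above (Suc n) t (z(Suc n := y))) *
      g (c + (\<Sum>i = 1..Suc n. (b i - b (i - 1)) * (z(Suc n := y)) i)) \<partial>?P) =
      indicator {t..} y * (\<integral>\<^sup>+z. of_bool (descending_above n y z) *
      g ((c + (b (Suc n) - b n) * y) + (\<Sum>i = 1..n. (b i - b (i - 1)) * z i)) \<partial>?P)"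
      unfolding e by (cases "t \<le> y") (simp_all add: descending_above_Suc add.assoc)
  qed
  also have "\<dots> = (\<integral>\<^sup>+y. indicator {t..} y * (ennreal (exp (- real n * y) / fact n) *
      ?H n (c + b (Suc n) * y)) \<partial>exponential_law)"
  proof (rule nn_integral_cong)
    fix y
    show "indicator {t..} y * (\<integral>\<^sup>+z. of_bool (descending_above n y z) *
      g ((c + (b (Suc n) - b n) * y) + (\<Sum>i = 1..n. (b i - b (i - 1)) * z i)) \<partial>?P) =
      indicator {t..} y * (ennreal (exp (- real n * y) / fact n) * ?H n (c + b (Suc n) * y))"
    proof (cases "t \<le> y")
      case True
      \<comment> \<open>The terms in \<open>b n\<close> telescope, leaving only
        \<open>b (Suc n)\<close> as the factor of \<open>y\<close>.\<close>
      have e: "c + (b (Suc n) - b n) * y + b n * y = c + b (Suc n) * y" by (simp add: algebra_simps)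
      have "0 \<le> y" using True Suc.prems by simp
      show ?thesis unfolding Suc.IH[OF \<open>0 \<le> y\<close>] e ..
    qed simp
  qed
  also have "\<dots> = (\<integral>\<^sup>+y. ennreal (exponential_density 1 y) * (indicator {t..} y *
      (ennreal (exp (- real n * y) / fact n) * ?H n (c + b (Suc n) * y))) \<partial>lborel)"
    by (rule nn_integral_density) measurable
  also have "\<dots> = (\<integral>\<^sup>+y. ennreal (1 / fact n) *
      (ennreal (exp (- ?m * y)) * indicator {t..} y * ?H n (c + b (Suc n) * y)) \<partial>lborel)"
  proof (rule nn_integral_cong)
    fix y
    show "ennreal (exponential_density 1 y) * (indicator {t..} y *
        (ennreal (exp (- real n * y) / fact n) * ?H n (c + b (Suc n) * y))) =
        ennreal (1 / fact n) *
        (ennreal (exp (- ?m * y)) * indicator {t..} y * ?H n (c + b (Suc n) * y))"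
    proof (cases "t \<le> y")
      case True
      \<comment> \<open>The density of the last coordinate adds rate 1 to the rate \<open>n\<close>
        supplied by the other coordinates.\<close>
      have "- y + - real n * y = - ?m * y" by (simp add: algebra_simps)
      hence "exp (- y) * (exp (- real n * y) / fact n) = 1 / fact n * exp (- ?m * y)"
        by (simp only: exp_add[symmetric] times_divide_eq_right) simp
      moreover have "exponential_density 1 y = exp (- y)"
        using True Suc.prems by (simp add: exponential_density_def)
      ultimately have "ennreal (exponential_density 1 y) * ennreal (exp (- real n * y) / fact n) =
          ennreal (1 / fact n) * ennreal (exp (- ?m * y))"
        by (metis ennreal_mult' exp_ge_zero fact_ge_zero zero_le_divide_1_iff)
      thus ?thesis using True by (simp only: mult.assoc[symmetric] mult_1_right indicator_simps atLeast_iff)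
    qed simp
  qed
  also have "\<dots> = ennreal (1 / fact n) * (\<integral>\<^sup>+y. ennreal (exp (- ?m * y)) * indicator {t..} y *
      ?H n (c + b (Suc n) * y) \<partial>lborel)"
    by (rule nn_integral_cmult) measurable
  also have "\<dots> = ennreal (1 / fact n) * (ennreal (exp (- ?m * t) / ?m) *
      (\<integral>\<^sup>+u. ennreal (exponential_density 1 u) * ?H n (c + b (Suc n) * (t + u / ?m)) \<partial>lborel))"
    by (subst nn_integral_exp_tail) (simp_all del: of_nat_Suc)
  \<comment> \<open>The factor of \<open>u\<close> is now \<open>b (Suc n) / Suc n\<close>, the next
    coefficient in the recursion of \<open>hypoexp_nn_integral\<close>.\<close>
  also have "(\<lambda>u. c + b (Suc n) * (t + u / ?m)) = (\<lambda>u. (c + b (Suc n) * t) + b (Suc n) / ?m * u)"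
    by (rule ext) (simp add: distrib_left add.assoc del: of_nat_Suc)
  also have "ennreal (1 / fact n) * (ennreal (exp (- ?m * t) / ?m) *
      (\<integral>\<^sup>+u. ennreal (exponential_density 1 u) *
         ?H n ((c + b (Suc n) * t) + b (Suc n) / ?m * u) \<partial>lborel)) =
      ennreal (exp (- ?m * t) / fact (Suc n)) * ?H (Suc n) (c + b (Suc n) * t)"
    by (simp add: mult.assoc[symmetric] ennreal_mult'[symmetric] mult.commute del: of_nat_Suc)
  finally show ?case .
qed

section \<open>Comparison of measures and laws of i.i.d. samples\<close>

text \<open>Since both total masses are 1, the inequality applied to the complement of a set is the
  reverse inequality for the set.\<close>

lemma measure_eqI_emeasure_le:
  assumes P: "prob_space P" and Q: "prob_space Q" and sets: "sets P = sets Q"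
    and le: "\<And>A. A \<in> sets P \<Longrightarrow> emeasure P A \<le> emeasure Q A"
  shows "P = Q"
proof (rule measure_eqI[OF sets])
  interpret P: prob_space P by fact
  interpret Q: prob_space Q by fact
  have space: "space P = space Q" using sets by (rule sets_eq_imp_space_eq)
  have le': "P.prob A \<le> Q.prob A" if "A \<in> sets P" for A
    using le[OF that] by (simp add: P.emeasure_eq_measure Q.emeasure_eq_measure)
  fix A assume A: "A \<in> sets P"
  have "P.prob (space P - A) \<le> Q.prob (space Q - A)"
    using le'[OF sets.compl_sets[OF A]] by (simp add: space)
  hence "Q.prob A \<le> P.prob A"
    using A sets by (simp add: P.prob_compl Q.prob_compl)
  thus "emeasure P A = emeasure Q A"
    using le'[OF A] by (simp add: P.emeasure_eq_measure Q.emeasure_eq_measure)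
qed

text \<open>The values of the distribution function at \<open>x\<close> \<ge> 0 already determine
  the law. The detour through \<open>lborel\<close> as target is harmless, as its measurable sets
  are those of \<open>borel\<close>.\<close>

lemma (in prob_space) distr_eq_exponential_law:
  assumes [measurable]: "X \<in> borel_measurable M"
    and cdf: "\<And>x. cdf (distr M borel X) x = (if x < 0 then 0 else 1 - exp (- x))"
  shows "distr M borel X = exponential_law"
proof -
  have "prob {\<omega> \<in> space M. X \<omega> \<le> x} = 1 - exp (- x)" if "0 \<le> x" for x
  proof -
    have "X -` {..x} \<inter> space M = {\<omega> \<in> space M. X \<omega> \<le> x}" by auto
    thus ?thesis using cdf[of x] that by (simp add: cdf_def measure_distr)
  qed
  hence "distributed M lborel X (exponential_density 1)"
    by (subst exponential_distributed_iff) simp_all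
  hence "distr M lborel X = exponential_law"
    by (rule distributed_distr_eq_density)
  moreover have "distr M lborel X = distr M borel X"
    by (rule distr_cong) simp_all
  ultimately show ?thesis by simp
qed

text \<open>Independence makes the joint law a product of copies of \<open>L\<close>, and reindexing
  by a permutation preserves a product of equal factors.\<close>

lemma (in prob_space) distr_permuted_iid:
  assumes indep: "indep_vars (\<lambda>_. N) X I" and ne: "I \<noteq> {}"
    and law: "\<And>i. i \<in> I \<Longrightarrow> distr M N (X i) = L" and \<sigma>: "\<sigma> permutes I"
  shows "distr M (\<Pi>\<^sub>M i\<in>I. L) (\<lambda>\<omega>. \<lambda>i\<in>I. X (\<sigma> i) \<omega>) = (\<Pi>\<^sub>M i\<in>I. L)"
proof -
  have rv: "random_variable N (X i)" if "i \<in> I" for i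
    using indep that by (auto simp: indep_vars_def)
  from ne obtain i0 where i0: "i0 \<in> I" by blast
  have sets: "sets L = sets N" using law[OF i0, symmetric] by simp
  have L: "prob_space L" using prob_space_distr[OF rv[OF i0]] by (simp add: law[OF i0])
  have setsP: "sets (\<Pi>\<^sub>M i\<in>I. N) = sets (\<Pi>\<^sub>M i\<in>I. L)"
    by (rule sets_PiM_cong) (simp_all add: sets)
  have "distr M (\<Pi>\<^sub>M i\<in>I. N) (\<lambda>\<omega>. \<lambda>i\<in>I. X i \<omega>) = (\<Pi>\<^sub>M i\<in>I. distr M N (X i))"
    using indep_vars_iff_distr_eq_PiM'[where X = X and M' = "\<lambda>_. N", OF ne rv] indep by blast
  also have "\<dots> = (\<Pi>\<^sub>M i\<in>I. L)" by (rule PiM_cong) (simp_all add: law)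
  finally have joint: "distr M (\<Pi>\<^sub>M i\<in>I. L) (\<lambda>\<omega>. \<lambda>i\<in>I. X i \<omega>) = (\<Pi>\<^sub>M i\<in>I. L)"
    using distr_cong[OF refl setsP, of M "\<lambda>\<omega>. \<lambda>i\<in>I. X i \<omega>" "\<lambda>\<omega>. \<lambda>i\<in>I. X i \<omega>"] by simp
  have rvL: "random_variable L (X i)" if "i \<in> I" for i
    using rv[OF that] measurable_cong_sets[OF refl sets] by blast
  have m1: "(\<lambda>\<omega>. \<lambda>i\<in>I. X i \<omega>) \<in> M \<rightarrow>\<^sub>M (\<Pi>\<^sub>M i\<in>I. L)"
    by (rule measurable_restrict) (rule rvL)
  have im: "\<sigma> i \<in> I" if "i \<in> I" for i using permutes_in_image[OF \<sigma>] that by simp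
  have m2: "(\<lambda>z. \<lambda>i\<in>I. z (\<sigma> i)) \<in> (\<Pi>\<^sub>M i\<in>I. L) \<rightarrow>\<^sub>M (\<Pi>\<^sub>M i\<in>I. L)"
    by (rule measurable_restrict) (rule measurable_component_singleton[OF im])
  have "distr M (\<Pi>\<^sub>M i\<in>I. L) (\<lambda>\<omega>. \<lambda>i\<in>I. X (\<sigma> i) \<omega>) =
      distr (distr M (\<Pi>\<^sub>M i\<in>I. L) (\<lambda>\<omega>. \<lambda>i\<in>I. X i \<omega>)) (\<Pi>\<^sub>M i\<in>I. L) (\<lambda>z. \<lambda>i\<in>I. z (\<sigma> i))"
    unfolding distr_distr[OF m2 m1] by (rule distr_cong) (auto simp: im)
  also have "\<dots> = (\<Pi>\<^sub>M i\<in>I. L)"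
    unfolding joint using distr_PiM_reindex[of I "\<lambda>_. L" \<sigma> I] L permutes_inj_on[OF \<sigma>] im by auto
  finally show ?thesis .
qed

section \<open>The density of the Choquet integral\<close>

text \<open>With ties several permutations sort \<open>x\<close>, but all give the same sum. The
  existential form turns preimages under the Choquet integral into finite unions.\<close>

lemma choquet_mem_iff:
  "choquet n \<nu> x \<in> A \<longleftrightarrow>
   (\<exists>\<sigma>\<in>{\<sigma>. \<sigma> permutes {1..n}}. sorting_perm n x \<sigma> \<and> (\<Sum>i = 1..n. chain_inc \<nu> \<sigma> i * x (\<sigma> i)) \<in> A)"
  using sorting_perm_exists[of n x] choquet_eq[of n x _ \<nu>] by (auto simp: sorting_perm_def)

theorem corollary8:
  fixes n :: nat and \<nu> :: "nat set \<Rightarrow> real"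
    and M :: "'a measure" and X :: "nat \<Rightarrow> 'a \<Rightarrow> real"
  assumes "n \<ge> 1"
    and "is_game n \<nu>"
    and "prob_space M"
    and "prob_space.indep_vars M (\<lambda>_. borel) X {1..n}"
    and "\<And>i x. i \<in> {1..n} \<Longrightarrow>
           cdf (distr M borel (X i)) x = (if x < 0 then 0 else 1 - exp (- x))"
    and "\<And>\<sigma> i k. \<lbrakk>\<sigma> permutes {1..n}; i \<in> {1..n}; k \<in> {1..n}; i \<noteq> k\<rbrakk> \<Longrightarrow>
           chain_val \<nu> \<sigma> i / real i \<noteq> chain_val \<nu> \<sigma> k / real k"
    and "\<And>\<sigma> i. \<lbrakk>\<sigma> permutes {1..n}; i \<in> {1..n}\<rbrakk> \<Longrightarrow> chain_val \<nu> \<sigma> i / real i > 0"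
  shows "\<exists>f :: real \<Rightarrow> real.
           (\<forall>y. 0 \<le> f y) \<and>
           distributed M lborel (\<lambda>\<omega>. choquet n \<nu> (\<lambda>i. X i \<omega>)) (\<lambda>y. ennreal (f y)) \<and>
           (\<forall>y\<ge>0. f y = 1 / fact n *
              (\<Sum>\<sigma> | \<sigma> permutes {1..n}. \<Sum>i = 1..n.
                 (chain_val \<nu> \<sigma> i / real i) powi (int n - 2) /
                 (\<Prod>k \<in> {1..n} - {i}. chain_val \<nu> \<sigma> i / real i - chain_val \<nu> \<sigma> k / real k) *
                 exp (- y / (chain_val \<nu> \<sigma> i / real i)))) \<and>
           (\<forall>y<0. f y = 0)"
proof -
  interpret prob_space M by fact
  let ?I = "{1..n}" and ?Perm = "{\<sigma>. \<sigma> permutes {1..n}}"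
  let ?E = "\<Pi>\<^sub>M i\<in>?I. exponential_law"
  define Y where "Y \<omega> = choquet n \<nu> (\<lambda>i. X i \<omega>)" for \<omega>
  define a where "a \<sigma> i = chain_val \<nu> \<sigma> i / real i" for \<sigma> i
  define f where "f y = (if y < 0 then 0 else
    1 / fact n * (\<Sum>\<sigma>\<in>?Perm. hypoexp_density (a \<sigma>) n y))" for y
  define S where "S \<sigma> z = (\<Sum>i = 1..n. chain_inc \<nu> \<sigma> i * z i)" for \<sigma> z
  have fin: "finite ?Perm" by (rule finite_permutations) simp
  have rv [measurable]: "X i \<in> borel_measurable M" if "i \<in> ?I" for i
    using assms(4) that by (auto simp: indep_vars_def)
  have law: "distr M borel (X i) = exponential_law" if "i \<in> ?I" for i
    using distr_eq_exponential_law[OF rv[OF that]] assms(5)[OF that] by blast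
  have im: "\<sigma> i \<in> ?I" if "\<sigma> \<in> ?Perm" "i \<in> ?I" for \<sigma> i
    using permutes_in_image[of \<sigma> ?I i] that by blast
  \<comment> \<open>This supplies the threshold 0 for \<open>descending_above\<close>; it holds only
    almost surely, so the integrands below are compared almost everywhere.\<close>
  have AE_nonneg: "AE \<omega> in M. \<forall>i\<in>?I. 0 \<le> X i \<omega>"
  proof (rule AE_finite_allI)
    fix i assume i: "i \<in> ?I"
    have "AE x in distr M borel (X i). 0 \<le> x"
      unfolding law[OF i] by (subst AE_density) (auto simp: exponential_density_def)
    thus "AE \<omega> in M. 0 \<le> X i \<omega>" by (subst (asm) AE_distr_iff) (use rv[OF i] in auto)
  qed simp
  have hypoexp: "0 \<le> y \<Longrightarrow> 0 \<le> hypoexp_density (a \<sigma>) n y"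
    "hypoexp_nn_integral g (a \<sigma>) n 0 =
       (\<integral>\<^sup>+y. ennreal (hypoexp_density (a \<sigma>) n y) * indicator {0..} y * g y \<partial>lborel)"
    if \<sigma>: "\<sigma> \<in> ?Perm" and g: "g \<in> borel_measurable borel" for \<sigma> y g
  proof -
    have "inj_on (a \<sigma>) ?I"
    proof (rule inj_onI, rule ccontr)
      fix i k assume "i \<in> ?I" "k \<in> ?I" "a \<sigma> i = a \<sigma> k" "i \<noteq> k"
      thus False using assms(6)[of \<sigma> i k] \<sigma> unfolding a_def by blast
    qed
    moreover have "0 < a \<sigma> i" if "i \<in> ?I" for i using assms(7)[of \<sigma> i] \<sigma> that by (simp add: a_def)
    ultimately show "0 \<le> y \<Longrightarrow> 0 \<le> hypoexp_density (a \<sigma>) n y"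
      "hypoexp_nn_integral g (a \<sigma>) n 0 =
       (\<integral>\<^sup>+y. ennreal (hypoexp_density (a \<sigma>) n y) * indicator {0..} y * g y \<partial>lborel)"
      using hypoexp_nn_integral_eq[OF g \<open>n \<ge> 1\<close>, of "a \<sigma>"] by auto
  qed
  have f_nonneg: "0 \<le> f y" for y
    unfolding f_def using hypoexp(1)[of _ "\<lambda>_. 0" y] by (auto intro!: sum_nonneg divide_nonneg_nonneg)
  have f_meas [measurable]: "f \<in> borel_measurable borel" unfolding f_def[abs_def] by measurable
  \<comment> \<open>The mixture of the hypoexponential laws over all \<sigma>, each with weight
    \<open>1 / fact n\<close>, has density \<open>f\<close>.\<close>
  have density: "(\<Sum>\<sigma>\<in>?Perm. ennreal (1 / fact n) * hypoexp_nn_integral (indicator A) (a \<sigma>) n 0) =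
      emeasure (density lborel f) A" if [measurable]: "A \<in> sets borel" for A
  proof -
    have "(\<Sum>\<sigma>\<in>?Perm. ennreal (1 / fact n) * hypoexp_nn_integral (indicator A) (a \<sigma>) n 0) =
      (\<Sum>\<sigma>\<in>?Perm. \<integral>\<^sup>+y. ennreal (1 / fact n) *
        (ennreal (hypoexp_density (a \<sigma>) n y) * indicator {0..} y * indicator A y) \<partial>lborel)"
      by (intro sum.cong refl) (simp add: hypoexp(2) nn_integral_cmult)
    also have "\<dots> = (\<integral>\<^sup>+y. (\<Sum>\<sigma>\<in>?Perm. ennreal (1 / fact n) *
        (ennreal (hypoexp_density (a \<sigma>) n y) * indicator {0..} y * indicator A y)) \<partial>lborel)"
      by (rule nn_integral_sum[symmetric]) measurable
    also have "\<dots> = (\<integral>\<^sup>+y. ennreal (f y) * indicator A y \<partial>lborel)"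
    proof (rule nn_integral_cong)
      fix y
      show "(\<Sum>\<sigma>\<in>?Perm. ennreal (1 / fact n) *
        (ennreal (hypoexp_density (a \<sigma>) n y) * indicator {0..} y * indicator A y)) =
        ennreal (f y) * indicator A y"
      proof (cases "0 \<le> y \<and> y \<in> A")
        case True
        hence nonneg: "0 \<le> hypoexp_density (a \<sigma>) n y" if "\<sigma> \<in> ?Perm" for \<sigma>
          using hypoexp(1)[OF that, of "\<lambda>_. 0"] by simp
        have "ennreal (f y) = ennreal (1 / fact n * (\<Sum>\<sigma>\<in>?Perm. hypoexp_density (a \<sigma>) n y))"
          using True by (simp add: f_def)
        also have "\<dots> = ennreal (1 / fact n) * ennreal (\<Sum>\<sigma>\<in>?Perm. hypoexp_density (a \<sigma>) n y)"
          by (rule ennreal_mult') simp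
        also have "ennreal (\<Sum>\<sigma>\<in>?Perm. hypoexp_density (a \<sigma>) n y) =
            (\<Sum>\<sigma>\<in>?Perm. ennreal (hypoexp_density (a \<sigma>) n y))"
          using nonneg by (rule sum_ennreal[symmetric])
        finally show ?thesis using True by (simp add: sum_distrib_left)
      qed (auto simp: f_def)
    qed
    finally show ?thesis by (simp add: emeasure_density)
  qed
  \<comment> \<open>For \<open>A = UNIV\<close> every hypoexponential expectation is 1, and
    \<open>n!\<close> weights \<open>1 / fact n\<close> add up to 1.\<close>
  have "emeasure (density lborel f) UNIV = (\<Sum>\<sigma>\<in>?Perm. ennreal (1 / fact n))"
    using density[of UNIV] hypoexp_nn_integral_1 by (simp add: indicator_def[abs_def])
  also have "\<dots> = ennreal (\<Sum>\<sigma>\<in>?Perm. 1 / fact n)"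
    by (rule sum_ennreal) simp
  also have "(\<Sum>\<sigma>\<in>?Perm. 1 / fact n) = (1 :: real)"
    using card_permutations[of ?I n] by simp
  finally have prob_f: "prob_space (density lborel f)"
    by (intro prob_spaceI) simp
  have S_meas [measurable]: "(\<lambda>\<omega>. S \<sigma> (\<lambda>i. X (\<sigma> i) \<omega>)) \<in> borel_measurable M" if "\<sigma> \<in> ?Perm" for \<sigma>
    unfolding S_def using im[OF that] rv by (intro borel_measurable_sum borel_measurable_times) auto
  \<comment> \<open>These events may overlap where the sample has ties; only subadditivity over
    \<sigma> is used below.\<close>
  define B where "B \<sigma> A = {\<omega> \<in> space M. sorting_perm n (\<lambda>i. X i \<omega>) \<sigma> \<and> S \<sigma> (\<lambda>i. X (\<sigma> i) \<omega>) \<in> A}" for \<sigma> A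
  have B_sets: "B \<sigma> A \<in> events" if \<sigma>: "\<sigma> \<in> ?Perm" and A: "A \<in> sets borel" for \<sigma> A
  proof -
    have "Measurable.pred M (\<lambda>\<omega>. i \<le> j \<longrightarrow> X (\<sigma> j) \<omega> \<le> X (\<sigma> i) \<omega>)" if "i \<in> ?I" "j \<in> ?I" for i j
      unfolding Measurable.pred_def
      using borel_measurable_le[OF rv[OF im[OF \<sigma> that(2)]] rv[OF im[OF \<sigma> that(1)]]]
      by (cases "i \<le> j") auto
    hence "Measurable.pred M (\<lambda>\<omega>. \<forall>i\<in>?I. \<forall>j\<in>?I. i \<le> j \<longrightarrow> X (\<sigma> j) \<omega> \<le> X (\<sigma> i) \<omega>)"
      by (intro pred_intros_finite(3) finite_atLeastAtMost)
    moreover have "Measurable.pred M (\<lambda>\<omega>. S \<sigma> (\<lambda>i. X (\<sigma> i) \<omega>) \<in> A)"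
      using S_meas[OF \<sigma>] A by measurable
    ultimately have "Measurable.pred M (\<lambda>\<omega>. (\<forall>i\<in>?I. \<forall>j\<in>?I. i \<le> j \<longrightarrow> X (\<sigma> j) \<omega> \<le> X (\<sigma> i) \<omega>) \<and>
        S \<sigma> (\<lambda>i. X (\<sigma> i) \<omega>) \<in> A)"
      by (intro pred_intros_logic(3))
    moreover have "B \<sigma> A = {\<omega> \<in> space M. (\<forall>i\<in>?I. \<forall>j\<in>?I. i \<le> j \<longrightarrow> X (\<sigma> j) \<omega> \<le> X (\<sigma> i) \<omega>) \<and>
        S \<sigma> (\<lambda>i. X (\<sigma> i) \<omega>) \<in> A}"
      using \<sigma> unfolding B_def sorting_perm_def by blast
    ultimately show ?thesis by (simp only: Measurable.pred_def)
  qed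
  have Y_eq: "Y -` A \<inter> space M = (\<Union>\<sigma>\<in>?Perm. B \<sigma> A)" for A
    by (auto simp: Y_def B_def S_def choquet_mem_iff)
  have Y_meas [measurable]: "Y \<in> borel_measurable M"
  proof (rule measurableI)
    show "Y -` A \<inter> space M \<in> events" if "A \<in> sets borel" for A
      unfolding Y_eq by (intro sets.finite_UN fin B_sets that)
  qed simp
  have emeasure_B: "emeasure M (B \<sigma> A) \<le> ennreal (1 / fact n) * hypoexp_nn_integral (indicator A) (a \<sigma>) n 0"
    if \<sigma>: "\<sigma> \<in> ?Perm" and A [measurable]: "A \<in> sets borel" for \<sigma> A
  proof -
    let ?Z = "\<lambda>\<omega>. \<lambda>i\<in>?I. X (\<sigma> i) \<omega>"
    let ?g = "\<lambda>z. of_bool (descending_above n 0 z) * indicator A (0 + S \<sigma> z) :: ennreal"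
    have Z: "?Z \<in> M \<rightarrow>\<^sub>M ?E"
    proof (rule measurable_restrict)
      fix i assume "i \<in> ?I"
      thus "X (\<sigma> i) \<in> M \<rightarrow>\<^sub>M exponential_law" using rv[OF im[OF \<sigma>]] by simp
    qed
    have g: "?g \<in> borel_measurable ?E" unfolding S_def by measurable
    have joint: "distr M ?E ?Z = ?E"
      using distr_permuted_iid[OF assms(4) _ law, of \<sigma>] \<sigma> \<open>n \<ge> 1\<close> by auto
    have "emeasure M (B \<sigma> A) = (\<integral>\<^sup>+\<omega>. indicator (B \<sigma> A) \<omega> \<partial>M)"
      using B_sets[OF \<sigma> A] by simp
    also have "\<dots> \<le> (\<integral>\<^sup>+\<omega>. ?g (?Z \<omega>) \<partial>M)"
    proof (rule nn_integral_mono_AE, use AE_nonneg in eventually_elim)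
      fix \<omega> assume nonneg: "\<forall>i\<in>?I. 0 \<le> X i \<omega>"
      have "S \<sigma> (?Z \<omega>) = S \<sigma> (\<lambda>i. X (\<sigma> i) \<omega>)" unfolding S_def by (intro sum.cong) auto
      moreover have "descending_above n 0 (?Z \<omega>)" if "sorting_perm n (\<lambda>i. X i \<omega>) \<sigma>"
        using that nonneg im[OF \<sigma>] by (auto simp: sorting_perm_def descending_above_def)
      ultimately show "indicator (B \<sigma> A) \<omega> \<le> ?g (?Z \<omega>)"
        by (auto simp: B_def indicator_def)
    qed
    also have "\<dots> = (\<integral>\<^sup>+z. ?g z \<partial>distr M ?E ?Z)"
      using g by (intro nn_integral_distr[symmetric] Z) (simp add: joint)
    \<comment> \<open>Here \<open>b\<close> is the chain of values of \<nu> along \<sigma>, with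
      \<open>t = 0\<close> and \<open>c = 0\<close>; \<open>b 0 = 0\<close> is the value of the game
      at the empty set.\<close>
    also have "\<dots> = ennreal (exp (- real n * 0) / fact n) *
        hypoexp_nn_integral (indicator A) (\<lambda>i. chain_val \<nu> \<sigma> i / real i) n (0 + chain_val \<nu> \<sigma> n * 0)"
      unfolding joint S_def chain_inc_def
      by (rule nn_integral_descending_above) (use \<open>is_game n \<nu>\<close> in \<open>simp_all add: chain_val_def is_game_def\<close>)
    finally show ?thesis by (simp add: a_def[abs_def])
  qed
  have "distr M lborel Y = density lborel f"
  proof (rule measure_eqI_emeasure_le)
    show "prob_space (distr M lborel Y)" by (rule prob_space_distr) simp
    show "emeasure (distr M lborel Y) A \<le> emeasure (density lborel f) A"
      if "A \<in> sets (distr M lborel Y)" for A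
    proof -
      have A: "A \<in> sets borel" using that by simp
      have "emeasure (distr M lborel Y) A = emeasure M (\<Union>\<sigma>\<in>?Perm. B \<sigma> A)"
        using A by (simp add: emeasure_distr Y_eq)
      also have "\<dots> \<le> (\<Sum>\<sigma>\<in>?Perm. emeasure M (B \<sigma> A))"
        using B_sets A by (intro emeasure_subadditive_finite fin) auto
      also have "\<dots> \<le> (\<Sum>\<sigma>\<in>?Perm. ennreal (1 / fact n) * hypoexp_nn_integral (indicator A) (a \<sigma>) n 0)"
        using emeasure_B A by (intro sum_mono) auto
      also have "\<dots> = emeasure (density lborel f) A" by (rule density[OF A])
      finally show ?thesis .
    qed
  qed (simp_all add: prob_f)
  hence "distributed M lborel Y (\<lambda>y. ennreal (f y))"
    by (simp add: distributed_def)
  thus ?thesis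
    using f_nonneg unfolding Y_def[abs_def]
    by (intro exI[of _ f]) (auto simp: f_def hypoexp_density_def a_def)
qed

end
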